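(* Let $d\geq 1$ and let $\Delta_d\subset\mathbb{R}^d$ be the unit $d$-simplex, i.e. the convex hull of the origin and the standard basis vectors $\mathbf{e}_1,\ldots,\mathbf{e}_d$. For an arbitrary $d$-tuple of integers $\mathbf{a}=(a_1,\ldots,a_d)\in\mathbb{Z}^d$, the refined Ehrhart series of $\Delta_d$ with weights $\mathbf{a}$ is $$E^{\mathbf{a}}_{\Delta_d}(t,q) = (1-t)^{-1}\prod_{j=1}^d(1-q^{a_j}t)^{-1}.$$
   Context: For a $d$-dimensional lattice polytope $\Sigma\subset\mathbb{R}^d$ (a compact convex polytope with vertices in $\mathbb{Z}^d$) and weights $\mathbf{a}=(a_1,\ldots,a_d)\in\mathbb{Z}^d$, let $r\Sigma$ denote the $r$-fold dilation of $\Sigma$ for an integer $r\geq 0$. For integers $k$ put $L^{\mathbf{a}}_\Sigma(r,k)=\#\{\mathbf{v}\in r\Sigma\cap\mathbb{Z}^d : \mathbf{v}\cdot\mathbf{a}=k\}$, where $\cdot$ is the standard inner product. The refined Ehrhart series is $$E^{\mathbf{a}}_\Sigma(t,q)=\sum_{r=0}^\infty\sum_{k\in\mathbb{Z}}L^{\mathbf{a}}_\Sigma(r,k)\,q^kt^r,$$ a formal power series in $t$ with coefficients in the Laurent polynomials $\mathbb{Z}[q,q^{-1}]$. Rational expressions are expanded as power series in $t$ over $\mathbb{Z}[q,q^{-1}]$. *)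

theory Defs
  imports
    "HOL-Analysis.Analysis"
    "HOL-Computational_Algebra.Formal_Power_Series"
    "HOL-Library.Poly_Mapping"
begin

text \<open>
  Vectors of dimension \<open>d\<close> are indexed by a finite type \<open>'d\<close> with \<open>d = CARD('d)\<close>; \<open>d \<ge> 1\<close> holds
  because types are nonempty. Finitely supported functions from the additive group \<open>int\<close> to \<open>int\<close>,
  with convolution as product, are the Laurent polynomials in one variable \<open>q\<close> over the integers.
\<close>

type_synonym laurent = "int \<Rightarrow>\<^sub>0 int"

definition q_pow :: "int \<Rightarrow> laurent" where
  "q_pow k = Poly_Mapping.single k 1"

definition weight_vec :: "int ^ 'd \<Rightarrow> real ^ 'd" where
  "weight_vec a = (\<chi> i. of_int (a $ i))"

definition dilate :: "nat \<Rightarrow> (real ^ 'd) set \<Rightarrow> (real ^ 'd) set" where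
  "dilate r S = (\<lambda>x. real r *\<^sub>R x) ` S"

definition lattice_points :: "(real ^ 'd) set" where
  "lattice_points = {v. \<forall>i. v $ i \<in> \<int>}"

definition refined_count :: "int ^ 'd \<Rightarrow> (real ^ 'd) set \<Rightarrow> nat \<Rightarrow> int \<Rightarrow> nat" where
  "refined_count a S r k =
     card {v \<in> dilate r S \<inter> lattice_points. v \<bullet> weight_vec a = of_int k}"

text \<open>
  The power series variable is \<open>t\<close>. \<open>Sum_any\<close> sums over all integers \<open>k\<close> with nonzero summand, which
  are finitely many if \<open>S\<close> is bounded (in particular, if \<open>S\<close> is a lattice polytope).
\<close>

definition refined_ehrhart_series :: "int ^ 'd \<Rightarrow> (real ^ 'd) set \<Rightarrow> laurent fps" where
  "refined_ehrhart_series a S =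
     Abs_fps (\<lambda>r. Sum_any (\<lambda>k. of_nat (refined_count a S r k) * q_pow k))"

definition unit_simplex :: "(real ^ 'd) set" where
  "unit_simplex = convex hull (insert 0 (range (\<lambda>i. axis i 1)))"

text \<open>
  \<open>inverse\<close> on power series is only available if the coefficients have an \<open>inverse\<close> operation, which
  Laurent polynomials lack. For constant term \<open>1\<close> (whose inverse is \<open>1\<close>) the following is
  the reciprocal; see \<open>recip_fps_unique\<close>. It is meaningful only in that case.
\<close>

definition recip_fps :: "'a :: comm_ring_1 fps \<Rightarrow> 'a fps" where
  "recip_fps f = fps_right_inverse f 1"

lemma recip_fps_right: "fps_nth f 0 = 1 \<Longrightarrow> f * recip_fps f = 1"
  unfolding recip_fps_def by (rule fps_right_inverse) simp

lemma recip_fps_unique: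
  assumes "fps_nth f 0 = 1"
  shows "f * g = 1 \<longleftrightarrow> g = recip_fps f"
proof
  assume "f * g = 1"
  have "g = g * (f * recip_fps f)" by (simp add: recip_fps_right assms)
  also have "\<dots> = (f * g) * recip_fps f" by (simp add: mult_ac)
  finally show "g = recip_fps f" using \<open>f * g = 1\<close> by simp
qed (simp add: recip_fps_right assms)

lemma q_pow_0: "q_pow 0 = 1"
  by (simp add: q_pow_def)

lemma q_pow_add: "q_pow (k + l) = q_pow k * q_pow l"
  by (simp add: q_pow_def mult_single)

lemma finite_lattice_points:
  assumes "bounded S"
  shows "finite (dilate r S \<inter> lattice_points)"
proof -
  have "bounded (dilate r S)"
    unfolding dilate_def by (rule bounded_scaling[OF assms])
  then obtain B where B: "\<And>x. x \<in> dilate r S \<Longrightarrow> norm x \<le> B"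
    unfolding bounded_iff by blast
  let ?I = "(of_int ` {- \<lceil>B\<rceil>..\<lceil>B\<rceil>} :: real set)"
  have "x $ i \<in> ?I" if "x \<in> dilate r S \<inter> lattice_points" for x i
  proof -
    from that obtain n where n: "x $ i = of_int n"
      by (auto simp: lattice_points_def elim: Ints_cases)
    have "\<bar>x $ i\<bar> \<le> B"
      using component_le_norm_cart[of x i] B[of x] that by auto
    with n have "- \<lceil>B\<rceil> \<le> n" "n \<le> \<lceil>B\<rceil>" by linarith+
    with n show ?thesis by auto
  qed
  then have "dilate r S \<inter> lattice_points \<subseteq> {v. \<forall>i. v $ i \<in> ?I}" by blast
  moreover have "finite {v :: real ^ 'a. \<forall>i. v $ i \<in> ?I}"
  proof (rule finite_subset)
    show "{v :: real ^ 'a. \<forall>i. v $ i \<in> ?I} \<subseteq> vec_lambda ` (UNIV \<rightarrow>\<^sub>E ?I)"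
    proof
      fix v :: "real ^ 'a" assume "v \<in> {v. \<forall>i. v $ i \<in> ?I}"
      then have "vec_nth v \<in> UNIV \<rightarrow>\<^sub>E ?I" by auto
      then show "v \<in> vec_lambda ` (UNIV \<rightarrow>\<^sub>E ?I)"
        by (intro image_eqI[of _ _ "vec_nth v"]) (simp_all add: vec_nth_inverse)
    qed
  qed (intro finite_imageI finite_PiE; simp)
  ultimately show ?thesis by (rule finite_subset)
qed

lemma finite_refined_count:
  assumes "bounded S"
  shows "finite {k. refined_count a S r k \<noteq> 0}"
proof (rule finite_subset)
  show "{k. refined_count a S r k \<noteq> 0}
    \<subseteq> (\<lambda>v. \<lfloor>v \<bullet> weight_vec a\<rfloor>) ` (dilate r S \<inter> lattice_points)"
  proof
    fix k assume "k \<in> {k. refined_count a S r k \<noteq> 0}"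
    then have "{v \<in> dilate r S \<inter> lattice_points. v \<bullet> weight_vec a = of_int k} \<noteq> {}"
      unfolding refined_count_def by (intro notI) (simp only: mem_Collect_eq card.empty)
    then obtain v where "v \<in> dilate r S \<inter> lattice_points" "v \<bullet> weight_vec a = of_int k"
      by blast
    then show "k \<in> (\<lambda>v. \<lfloor>v \<bullet> weight_vec a\<rfloor>) ` (dilate r S \<inter> lattice_points)"
      by (intro image_eqI[of _ _ v]) simp_all
  qed
qed (simp add: finite_lattice_points assms)

lemma lookup_refined_ehrhart_series:
  assumes "bounded S"
  shows "Poly_Mapping.lookup (fps_nth (refined_ehrhart_series a S) r) k = int (refined_count a S r k)"
proof -
  let ?K = "{k. refined_count a S r k \<noteq> 0}"
  have monomial: "of_nat n * q_pow l = Poly_Mapping.single l (int n)" for n l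
    using mult_single[of 0 "int n" l 1] by (simp add: q_pow_def)
  have "fps_nth (refined_ehrhart_series a S) r
      = (\<Sum>l\<in>?K. Poly_Mapping.single l (int (refined_count a S r l)))"
    unfolding refined_ehrhart_series_def fps_nth_Abs_fps monomial
    by (rule Sum_any.expand_superset[OF finite_refined_count[OF assms]])
      (auto intro: gr0I)
  then show ?thesis
    using finite_refined_count[OF assms, of a r]
    by (auto simp: lookup_sum lookup_single when_def)
qed

end

theory Submission
  imports Defs
begin

text \<open>
  Both sides enumerate the vectors \<open>c \<in> \<nat>\<^sup>d\<close> with \<open>\<Sum>j. c j \<le> r\<close> by the value of \<open>\<Sum>j. a j * c j\<close>.

  Geometrically, the \<open>r\<close>-fold dilation of the simplex consists of the vectors with nonnegative
  coordinates of sum at most \<open>r\<close> (\<open>mem_dilate_unit_simplex\<close>), so its lattice points are exactly these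
  \<open>c\<close> (\<open>refined_count_unit_simplex\<close>).

  Algebraically, each factor \<open>(1 - q\<^sup>b t)\<^sup>-\<^sup>1\<close> is a geometric series. The product over \<open>j\<close> is the
  generating function of the complete homogeneous symmetric polynomials in the \<open>q\<^sup>b\<close>, so its
  coefficient at \<open>t\<^sup>n\<close>
  sums the monomials of the exponent vectors of total degree exactly \<open>n\<close>
  (\<open>fps_nth_prod_recip_linear\<close>). The remaining factor \<open>(1 - t)\<^sup>-\<^sup>1\<close> forms partial sums over \<open>n \<le> r\<close>,
  which turns total degree \<open>n\<close> into total degree at most \<open>r\<close>.
\<close>

lemma recip_linear_eq_geometric:
  "recip_fps (1 - fps_const b * fps_X) = Abs_fps (\<lambda>n. b ^ n)"
proof -
  have "(1 - fps_const b * fps_X) * Abs_fps (\<lambda>n. b ^ n) = 1"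
  proof (rule fps_ext)
    fix n
    show "fps_nth ((1 - fps_const b * fps_X) * Abs_fps (\<lambda>n. b ^ n)) n = fps_nth 1 n"
      by (cases n) (simp_all add: algebra_simps)
  qed
  then show ?thesis
    by (subst (asm) recip_fps_unique) simp_all
qed

text \<open>
  Exponents are forced to vanish outside \<open>S\<close>, so that an exponent vector is determined by its values
  on \<open>S\<close> and the set is finite whenever \<open>S\<close> is.
\<close>

definition exponents_of_degree :: "'i set \<Rightarrow> nat \<Rightarrow> ('i \<Rightarrow> nat) set" where
  "exponents_of_degree S n = {c. (\<forall>i. i \<notin> S \<longrightarrow> c i = 0) \<and> sum c S = n}"

lemma finite_exponents_of_degree:
  assumes "finite S"
  shows "finite (exponents_of_degree S n)"
proof (rule finite_subset)
  show "exponents_of_degree S n \<subseteq> {c. \<forall>i. (i \<in> S \<longrightarrow> c i \<in> {..n}) \<and> (i \<notin> S \<longrightarrow> c i = 0)}"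
    using assms by (auto simp: exponents_of_degree_def intro: member_le_sum)
qed (rule finite_set_of_finite_funs; simp add: assms)

text \<open>
  Multiplying by one more geometric series chooses the exponent of the new variable freely, and the
  old ones carry the remaining degree.
\<close>

lemma fps_nth_prod_recip_linear:
  fixes b :: "'i \<Rightarrow> 'a :: comm_ring_1"
  assumes "finite S"
  shows "fps_nth (\<Prod>j\<in>S. recip_fps (1 - fps_const (b j) * fps_X)) n =
    (\<Sum>c\<in>exponents_of_degree S n. \<Prod>j\<in>S. b j ^ c j)"
  using assms
proof (induction S arbitrary: n rule: finite_induct)
  case empty
  have "exponents_of_degree {} n = (if n = 0 then {\<lambda>_::'i. 0} else {})"
    by (auto simp: exponents_of_degree_def)
  then show ?case by simp
next
  case (insert j S)
  let ?Q = "SIGMA i:{0..n}. exponents_of_degree S (n - i)"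
  have "fps_nth (\<Prod>j\<in>insert j S. recip_fps (1 - fps_const (b j) * fps_X)) n =
      (\<Sum>i=0..n. \<Sum>c\<in>exponents_of_degree S (n - i). b j ^ i * (\<Prod>l\<in>S. b l ^ c l))"
    using insert by (simp add: fps_mult_nth recip_linear_eq_geometric sum_distrib_left)
  also have "\<dots> = (\<Sum>(i, c)\<in>?Q. b j ^ i * (\<Prod>l\<in>S. b l ^ c l))"
    using insert(1) by (intro sum.Sigma) (auto intro: finite_exponents_of_degree)
  also have "\<dots> = (\<Sum>c\<in>exponents_of_degree (insert j S) n. \<Prod>l\<in>insert j S. b l ^ c l)"
  proof (rule sum.reindex_bij_witness[of _ "\<lambda>c. (c j, c(j := 0))" "\<lambda>(i, c). c(j := i)"])
    have off_j: "sum (c(j := m)) S = sum c S" "(\<Prod>l\<in>S. b l ^ (c(j := m)) l) = (\<Prod>l\<in>S. b l ^ c l)"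
      for c m
      using insert(2) by (auto intro!: sum.cong prod.cong)
    fix p assume p: "p \<in> ?Q"
    show "(case p of (i, c) \<Rightarrow> c(j := i)) \<in> exponents_of_degree (insert j S) n"
      using p insert(1,2) by (auto simp: exponents_of_degree_def off_j simp del: fun_upd_apply)
        (auto)
    show "(\<lambda>c. (c j, c(j := 0))) (case p of (i, c) \<Rightarrow> c(j := i)) = p"
      using p insert(2) by (auto simp: exponents_of_degree_def)
    show "(\<Prod>l\<in>insert j S. b l ^ (case p of (i, c) \<Rightarrow> c(j := i)) l) =
        (case p of (i, c) \<Rightarrow> b j ^ i * (\<Prod>l\<in>S. b l ^ c l))"
      using insert(1,2) by (cases p) (simp add: off_j del: fun_upd_apply, simp)
  next
    fix c assume c: "c \<in> exponents_of_degree (insert j S) n"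
    show "(case (c j, c(j := 0)) of (i, c) \<Rightarrow> c(j := i)) = c" by simp
    have "sum (c(j := 0)) S = sum c S"
      using insert(2) by (auto intro!: sum.cong)
    then show "(c j, c(j := 0)) \<in> ?Q"
      using c insert(1,2) by (auto simp: exponents_of_degree_def)
  qed
  finally show ?case .
qed

lemma q_pow_sum: "q_pow (sum f S) = (\<Prod>j\<in>S. q_pow (f j))"
  by (induction S rule: infinite_finite_induct) (simp_all add: q_pow_0 q_pow_add)

lemma q_pow_power: "q_pow k ^ n = q_pow (k * int n)"
  by (induction n) (simp_all add: q_pow_0 algebra_simps flip: q_pow_add)

lemma lookup_sum_q_pow:
  assumes "finite A"
  shows "Poly_Mapping.lookup (\<Sum>x\<in>A. q_pow (f x)) k = int (card {x \<in> A. f x = k})"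
proof -
  have "Poly_Mapping.lookup (\<Sum>x\<in>A. q_pow (f x)) k = (\<Sum>x\<in>A. if f x = k then 1 else 0)"
    by (simp add: lookup_sum q_pow_def lookup_single when_def eq_commute)
  also have "\<dots> = int (card {x \<in> A. f x = k})"
    using assms by (simp flip: sum.inter_filter)
  finally show ?thesis .
qed

lemma unit_simplex_eq:
  "(unit_simplex :: (real ^ 'd) set) = {x. (\<forall>i. 0 \<le> x $ i) \<and> (\<Sum>i\<in>UNIV. x $ i) \<le> 1}"
proof -
  have Basis: "(Basis :: (real ^ 'd) set) = range (\<lambda>i. axis i 1)"
    by (auto simp: Basis_vec_def)
  have "inj (\<lambda>i. axis i 1 :: real ^ 'd)"
    by (auto simp: inj_on_def axis_eq_axis)
  then have "(\<Sum>b\<in>Basis. x \<bullet> b) = (\<Sum>i\<in>UNIV. x $ i)" for x :: "real ^ 'd"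
    unfolding Basis by (subst sum.reindex) (simp_all add: inner_axis)
  moreover have "(\<forall>b\<in>Basis. 0 \<le> x \<bullet> b) \<longleftrightarrow> (\<forall>i. 0 \<le> x $ i)" for x :: "real ^ 'd"
    by (simp add: Basis inner_axis)
  ultimately show ?thesis
    unfolding unit_simplex_def Basis[symmetric] std_simplex by simp
qed

lemma mem_dilate_unit_simplex:
  fixes v :: "real ^ 'd"
  shows "v \<in> dilate r unit_simplex \<longleftrightarrow> (\<forall>i. 0 \<le> v $ i) \<and> (\<Sum>i\<in>UNIV. v $ i) \<le> real r"
proof
  assume "v \<in> dilate r unit_simplex"
  then obtain x where x: "v = real r *\<^sub>R x" "\<forall>i. 0 \<le> x $ i" "(\<Sum>i\<in>UNIV. x $ i) \<le> 1"
    by (auto simp: dilate_def unit_simplex_eq)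
  then show "(\<forall>i. 0 \<le> v $ i) \<and> (\<Sum>i\<in>UNIV. v $ i) \<le> real r"
    by (auto simp: mult_left_le simp flip: sum_distrib_left)
next
  assume v: "(\<forall>i. 0 \<le> v $ i) \<and> (\<Sum>i\<in>UNIV. v $ i) \<le> real r"
  \<comment> \<open>If \<open>r = 0\<close>, then \<open>v = 0\<close>, and the preimage \<open>v / r\<close> is \<open>0\<close> because \<open>1 / 0 = 0\<close>.\<close>
  have "v = 0" if "r = 0"
  proof -
    have "(\<Sum>i\<in>UNIV. v $ i) = 0"
      using v that by (intro antisym) (auto intro: sum_nonneg)
    then show ?thesis
      using v by (simp add: sum_nonneg_eq_0_iff vec_eq_iff)
  qed
  then have "v = real r *\<^sub>R ((1 / real r) *\<^sub>R v)" by (cases "r = 0") simp_all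
  moreover have "(1 / real r) *\<^sub>R v \<in> unit_simplex"
    using v by (auto simp: unit_simplex_eq divide_le_eq_1 simp flip: sum_divide_distrib)
  ultimately show "v \<in> dilate r unit_simplex"
    unfolding dilate_def by (rule image_eqI)
qed

lemma bounded_unit_simplex: "bounded (unit_simplex :: (real ^ 'd) set)"
  unfolding unit_simplex_def by (intro finite_imp_bounded_convex_hull) simp

lemma refined_count_unit_simplex:
  fixes a :: "int ^ 'd"
  shows "refined_count a unit_simplex r k =
    card {c :: 'd \<Rightarrow> nat. sum c UNIV \<le> r \<and> (\<Sum>j\<in>UNIV. a $ j * int (c j)) = k}"
    (is "_ = card ?C")
proof -
  let ?v = "\<lambda>c :: 'd \<Rightarrow> nat. (\<chi> i. real (c i)) :: real ^ 'd"
  have weight: "?v c \<bullet> weight_vec a = of_int (\<Sum>j\<in>UNIV. a $ j * int (c j))" for c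
    by (simp add: inner_vec_def weight_vec_def mult.commute)
  have degree: "(\<Sum>i\<in>UNIV. ?v c $ i) \<le> real r \<longleftrightarrow> sum c UNIV \<le> r" for c
    by (simp flip: of_nat_sum)
  have "bij_betw ?v ?C {v \<in> dilate r unit_simplex \<inter> lattice_points. v \<bullet> weight_vec a = of_int k}"
    (is "bij_betw _ _ ?V")
  proof (rule bij_betw_imageI)
    show "inj_on ?v ?C" by (auto simp: inj_on_def vec_eq_iff)
    show "?v ` ?C = ?V"
    proof (intro equalityI subsetI)
      fix v assume "v \<in> ?v ` ?C"
      then obtain c where c: "c \<in> ?C" "v = ?v c" by blast
      then show "v \<in> ?V"
        using degree[of c] weight[of c] by (simp add: mem_dilate_unit_simplex lattice_points_def)
    next
      fix v assume v: "v \<in> ?V"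
      then have nonneg: "0 \<le> v $ i" and int: "v $ i \<in> \<int>" for i
        by (auto simp: mem_dilate_unit_simplex lattice_points_def)
      define c where "c i = nat \<lfloor>v $ i\<rfloor>" for i
      have "v = ?v c"
        using nonneg int by (auto simp: vec_eq_iff c_def)
      then show "v \<in> ?v ` ?C"
        using v degree[of c] weight[of c]
        by (intro image_eqI[of _ _ c]) (simp_all add: mem_dilate_unit_simplex del: of_int_sum)
    qed
  qed
  from bij_betw_same_card[OF this] show ?thesis
    unfolding refined_count_def by (rule sym)
qed

theorem proposition2p1:
  fixes a :: "int ^ 'd"
  shows "refined_ehrhart_series a unit_simplex =
    recip_fps (1 - fps_X) *
    (\<Prod>j\<in>UNIV. recip_fps (1 - fps_const (q_pow (a $ j)) * fps_X))"
proof (rule fps_ext, rule poly_mapping_eqI)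
  fix r k
  let ?P = "\<Prod>j\<in>UNIV. recip_fps (1 - fps_const (q_pow (a $ j)) * fps_X)"
  let ?weight = "\<lambda>c :: 'd \<Rightarrow> nat. \<Sum>j\<in>UNIV. a $ j * int (c j)"
  let ?E = "\<lambda>n. exponents_of_degree (UNIV :: 'd set) n"
  have fin: "finite (?E n)" for n
    by (rule finite_exponents_of_degree) simp
  have bounded_degree: "(\<Union>n\<in>{0..r}. ?E n) = {c. sum c UNIV \<le> r}"
    by (auto simp: exponents_of_degree_def)
  have "recip_fps (1 - fps_X) = Abs_fps (\<lambda>_. 1 :: laurent)"
    using recip_linear_eq_geometric[of "1 :: laurent"] by simp
  then have "fps_nth (recip_fps (1 - fps_X) * ?P) r = (\<Sum>n=0..r. fps_nth ?P n)"
    by (simp add: mult.commute[of _ ?P] fps_mult_nth)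
  also have "\<dots> = (\<Sum>n=0..r. \<Sum>c\<in>?E n. q_pow (?weight c))"
    by (simp add: fps_nth_prod_recip_linear q_pow_power q_pow_sum)
  also have "\<dots> = (\<Sum>c\<in>(\<Union>n\<in>{0..r}. ?E n). q_pow (?weight c))"
    by (rule sum.UNION_disjoint[symmetric]) (auto simp: fin, auto simp: exponents_of_degree_def)
  finally have "fps_nth (recip_fps (1 - fps_X) * ?P) r =
      (\<Sum>c\<in>(\<Union>n\<in>{0..r}. ?E n). q_pow (?weight c))" .
  then have "Poly_Mapping.lookup (fps_nth (recip_fps (1 - fps_X) * ?P) r) k =
      int (card {c \<in> (\<Union>n\<in>{0..r}. ?E n). ?weight c = k})"
    by (simp only:) (rule lookup_sum_q_pow, simp add: fin)
  also have "\<dots> = int (refined_count a unit_simplex r k)"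
    unfolding bounded_degree refined_count_unit_simplex by simp
  also have "\<dots> = Poly_Mapping.lookup (fps_nth (refined_ehrhart_series a unit_simplex) r) k"
    by (rule lookup_refined_ehrhart_series[OF bounded_unit_simplex, symmetric])
  finally show "Poly_Mapping.lookup (fps_nth (refined_ehrhart_series a unit_simplex) r) k =
      Poly_Mapping.lookup (fps_nth (recip_fps (1 - fps_X) * ?P) r) k" ..
qed

end
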